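(* For all real $\omega$, $$|Q_{0,2}(i\omega)|^2-|P_{0,2}(i\omega)|^2=\frac{\omega^4}{4},\qquad |Q_{1,2}(i\omega)|^2-|P_{1,2}(i\omega)|^2=\frac{\omega^4}{36},\qquad |Q_{1,3}(i\omega)|^2-|P_{1,3}(i\omega)|^2=\frac{\omega^6}{576},$$ with $|P_{0,2}(i\omega)|^2=1$, $|P_{1,2}(i\omega)|^2=1+\omega^2/9$, and $|P_{1,3}(i\omega)|^2=1+\omega^2/16$. Each of the three maps $R_{m,n}=P_{m,n}/Q_{m,n}$ therefore obeys $$|R_{m,n}(i\omega)|^2=\frac{|P_{m,n}(i\omega)|^2}{|P_{m,n}(i\omega)|^2+c\,\omega^{q}},\qquad 1-|R_{m,n}(i\omega)|=\frac{c}{2}\,\omega^{q}+O(\omega^{q+2})\quad(\omega\to0),$$ with $(c,q)=(\tfrac14,4)$ for $(m,n)=(0,2)$, $(c,q)=(\tfrac1{36},4)$ for $(m,n)=(1,2)$, and $(c,q)=(\tfrac1{576},6)$ for $(m,n)=(1,3)$.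
   Context: $R_{m,n}=P_{m,n}/Q_{m,n}$ is the $[m/n]$ Padé approximant of $e^z$: $\deg P_{m,n}=m$, $\deg Q_{m,n}=n$, $Q_{m,n}(0)=1$, and $P_{m,n}(z)/Q_{m,n}(z)-e^z=O(z^{m+n+1})$. Explicitly $P_{0,2}=1$, $Q_{0,2}(z)=1-z+\frac12z^2$; $P_{1,2}(z)=1+\frac13z$, $Q_{1,2}(z)=1-\frac23z+\frac16z^2$; $P_{1,3}(z)=1+\frac14z$, $Q_{1,3}(z)=1-\frac34z+\frac14z^2-\frac1{24}z^3$. *)

theory Defs
  imports "HOL-Analysis.Analysis" "HOL-Library.Landau_Symbols"
    "HOL-Computational_Algebra.Polynomial"
begin

text \<open>
  \<open>P / Q\<close> is the \<open>[m/n]\<close> Pade approximant of the exponential function. As the quotient is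
  compared with \<open>exp\<close> on a punctured neighbourhood of \<open>0\<close> and \<open>Q\<close> does not vanish near \<open>0\<close>,
  the totalised division plays no role.
\<close>

definition is_exp_pade :: "nat \<Rightarrow> nat \<Rightarrow> complex poly \<Rightarrow> complex poly \<Rightarrow> bool" where
  "is_exp_pade m n P Q \<longleftrightarrow>
     degree P = m \<and> degree Q = n \<and> poly Q 0 = 1 \<and>
     (\<lambda>z. poly P z / poly Q z - exp z) \<in> O[at 0](\<lambda>z. z ^ (m + n + 1))"

text \<open>
  The pair \<open>(P, Q)\<close> is selected by definite description. That such a pair exists and is unique
  for \<open>(m, n) = (0, 2), (1, 2), (1, 3)\<close>, and what it is, is proved below.
\<close>

definition exp_pade_pair :: "nat \<Rightarrow> nat \<Rightarrow> complex poly \<times> complex poly" where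
  "exp_pade_pair m n = (THE (P, Q). is_exp_pade m n P Q)"

definition exp_pade_num :: "nat \<Rightarrow> nat \<Rightarrow> complex poly" where
  "exp_pade_num m n = fst (exp_pade_pair m n)"

definition exp_pade_den :: "nat \<Rightarrow> nat \<Rightarrow> complex poly" where
  "exp_pade_den m n = snd (exp_pade_pair m n)"

definition exp_pade :: "nat \<Rightarrow> nat \<Rightarrow> complex \<Rightarrow> complex" where
  "exp_pade m n z = poly (exp_pade_num m n) z / poly (exp_pade_den m n) z"

lemma poly_bigo_imp_0:
  fixes p :: "complex poly"
  assumes "degree p < N" and "poly p \<in> O[at 0](\<lambda>z. z ^ N)"
  shows "p = 0"
proof (rule ccontr)
  assume "p \<noteq> 0"
  then obtain q where q: "p = [:- 0, 1:] ^ order 0 p * q" "\<not> [:- 0, 1:] dvd q"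
    using order_decomp by blast
  define k where "k = order 0 p"
  have "k < N" using order_degree[OF \<open>p \<noteq> 0\<close>, of 0] assms(1) by (simp add: k_def)
  have q0: "poly q 0 \<noteq> 0" using q(2) by (simp add: poly_eq_0_iff_dvd)
  obtain c where c: "eventually (\<lambda>z. norm (poly p z) \<le> c * norm (z ^ N)) (at 0)"
    using assms(2) by (elim landau_o.bigE)
  have pz: "poly p z = z ^ k * poly q z" for z
    by (subst q(1)) (simp add: k_def)
  have "eventually (\<lambda>z. norm (poly q z) \<le> c * norm (z ^ (N - k))) (at 0)"
    using c eventually_neq_at_within[of 0 0 UNIV]
  proof eventually_elim
    case (elim z)
    have "norm (z ^ N) = norm (z ^ k) * norm (z ^ (N - k))"
      using \<open>k < N\<close> by (simp flip: norm_mult power_add)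
    hence "norm (z ^ k) * norm (poly q z) \<le> norm (z ^ k) * (c * norm (z ^ (N - k)))"
      using elim by (simp add: pz norm_mult algebra_simps)
    thus ?case using elim by (subst (asm) mult_le_cancel_left_pos) auto
  qed
  moreover have "((\<lambda>z::complex. norm (poly q z)) \<longlongrightarrow> norm (poly q 0)) (at 0)"
    by (intro tendsto_intros)
  moreover have "((\<lambda>z::complex. c * norm (z ^ (N - k))) \<longlongrightarrow> c * norm ((0::complex) ^ (N - k))) (at 0)"
    by (intro tendsto_intros)
  ultimately have "norm (poly q 0) \<le> c * norm ((0::complex) ^ (N - k))"
    using tendsto_le[of "at (0::complex)"] by fastforce
  thus False using q0 \<open>k < N\<close> by (simp add: power_0_left)
qed

lemma is_exp_padeI:
  assumes "degree P = m" "degree Q = n" "poly Q 0 = 1"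
    and S: "\<And>z. poly P z - poly Q z * (\<Sum>i\<le>m + n. z ^ i / fact i) = z ^ (m + n + 1) * poly S z"
  shows "is_exp_pade m n P Q"
proof -
  let ?N = "m + n + 1"
  let ?T = "\<lambda>z::complex. \<Sum>i\<le>m + n. z ^ i / fact i"
  have Q: "(poly Q \<longlongrightarrow> poly Q 0) (at 0)"
    by (intro tendsto_intros)
  have ev: "eventually (\<lambda>z. poly Q z \<noteq> 0) (at 0)"
    using Q assms(3) by (intro tendsto_imp_eventually_ne[OF Q]) auto
  have "((\<lambda>z. poly S z / poly Q z) \<longlongrightarrow> poly S 0 / poly Q 0) (at 0)"
    using assms(3) by (intro tendsto_intros) auto
  hence "(\<lambda>z. poly S z / poly Q z) \<in> O[at 0](\<lambda>_. 1)"
    by (intro bigoI_tendsto[where c = "poly S 0 / poly Q 0"]) auto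
  hence "(\<lambda>z. z ^ ?N * (poly S z / poly Q z)) \<in> O[at 0](\<lambda>z. z ^ ?N * 1)"
    by (intro landau_o.big.mult) auto
  moreover have "(\<lambda>z::complex. exp z - ?T z) \<in> O[at 0](\<lambda>z. z ^ ?N)"
  proof (rule bigoI)
    have "((\<lambda>z::complex. exp (norm z)) \<longlongrightarrow> exp (norm (0::complex))) (at 0)"
      by (intro tendsto_intros)
    hence "eventually (\<lambda>z::complex. exp (norm z) < 2) (at 0)"
      by (intro order_tendstoD) auto
    thus "eventually (\<lambda>z::complex. norm (exp z - ?T z) \<le> (2 / fact (m + n)) * norm (z ^ ?N)) (at 0)"
    proof eventually_elim
      case (elim z)
      have "norm (exp z - ?T z) \<le> exp (norm z) * (norm z ^ Suc (m + n)) / fact (m + n)"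
        by (rule Taylor_exp_field)
      also have "\<dots> \<le> 2 * (norm z ^ Suc (m + n)) / fact (m + n)"
        using elim by (intro divide_right_mono mult_right_mono) auto
      finally show ?case by (simp add: norm_power norm_mult)
    qed
  qed
  ultimately have "(\<lambda>z. z ^ ?N * (poly S z / poly Q z) - (exp z - ?T z)) \<in> O[at 0](\<lambda>z. z ^ ?N)"
    by (subst (asm) mult_1_right) (rule sum_in_bigo(2))
  moreover have "eventually (\<lambda>z. z ^ ?N * (poly S z / poly Q z) - (exp z - ?T z)
      = poly P z / poly Q z - exp z) (at 0)"
    using ev
  proof eventually_elim
    case (elim z)
    have "z ^ ?N * (poly S z / poly Q z) = (poly P z - poly Q z * ?T z) / poly Q z"
      using S[of z] by simp
    also have "\<dots> = poly P z / poly Q z - ?T z"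
      using elim by (simp add: diff_divide_distrib)
    finally show ?case by simp
  qed
  ultimately have "(\<lambda>z. poly P z / poly Q z - exp z) \<in> O[at 0](\<lambda>z. z ^ ?N)"
    by (rule landau_o.big.in_cong[THEN iffD1, rotated])
  thus ?thesis using assms by (simp add: is_exp_pade_def)
qed

lemma is_exp_pade_cross_eq:
  assumes 1: "is_exp_pade m n P Q" and 2: "is_exp_pade m n P' Q'"
  shows "P * Q' = P' * Q"
proof -
  let ?N = "m + n + 1"
  have lim: "(poly q \<longlongrightarrow> poly q 0) (at (0::complex))" for q
    by (intro tendsto_intros)
  have O1: "poly q \<in> O[at (0::complex)](\<lambda>_. 1)" for q
    by (rule bigoI_tendsto[where c = "poly q 0"]) (auto intro: lim)
  have ne: "eventually (\<lambda>z. poly q z \<noteq> 0) (at 0)" if "poly q 0 = 1" for q :: "complex poly"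
    using that by (intro tendsto_imp_eventually_ne[OF lim]) auto
  have "(\<lambda>z. (poly P z / poly Q z - exp z) - (poly P' z / poly Q' z - exp z)) \<in> O[at 0](\<lambda>z. z ^ ?N)"
    by (rule sum_in_bigo(2)) (use 1 2 in \<open>simp_all add: is_exp_pade_def\<close>)
  hence "(\<lambda>z. poly (Q * Q') z * ((poly P z / poly Q z - exp z) - (poly P' z / poly Q' z - exp z)))
      \<in> O[at 0](\<lambda>z. 1 * z ^ ?N)"
    by (intro landau_o.big.mult O1)
  moreover have "eventually (\<lambda>z. poly (Q * Q') z * ((poly P z / poly Q z - exp z) -
      (poly P' z / poly Q' z - exp z)) = poly (P * Q' - P' * Q) z) (at 0)"
  proof -
    have "eventually (\<lambda>z. poly Q z \<noteq> 0) (at 0)" "eventually (\<lambda>z. poly Q' z \<noteq> 0) (at 0)"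
      using 1 2 by (auto intro!: ne simp: is_exp_pade_def)
    thus ?thesis by eventually_elim (simp add: field_simps)
  qed
  ultimately have "poly (P * Q' - P' * Q) \<in> O[at 0](\<lambda>z. z ^ ?N)"
    unfolding mult_1_left by (rule landau_o.big.in_cong[THEN iffD1, rotated])
  moreover have "degree (P * Q' - P' * Q) < ?N"
    using 1 2 degree_mult_le[of P Q'] degree_mult_le[of P' Q] degree_diff_le_max[of "P * Q'" "P' * Q"]
    by (auto simp: is_exp_pade_def)
  ultimately have "P * Q' - P' * Q = 0" by (rule poly_bigo_imp_0[rotated])
  thus ?thesis by simp
qed

lemma exp_pade_pair_eqI:
  assumes pq: "is_exp_pade m n P Q" and bezout: "A * P + B * Q = 1"
  shows "exp_pade_pair m n = (P, Q)"
  unfolding exp_pade_pair_def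
proof (rule the_equality)
  show "case (P, Q) of (P, Q) \<Rightarrow> is_exp_pade m n P Q" using pq by simp
next
  fix PQ' assume "case PQ' of (P, Q) \<Rightarrow> is_exp_pade m n P Q"
  then obtain P' Q' where [simp]: "PQ' = (P', Q')" and pq': "is_exp_pade m n P' Q'"
    by (cases PQ') auto
  have eq: "P * Q' = P' * Q" using is_exp_pade_cross_eq[OF pq pq'] .
  have "Q dvd P * Q'" by (simp add: eq)
  hence "Q dvd A * (P * Q') + Q * (B * Q')" by simp
  also have "A * (P * Q') + Q * (B * Q') = (A * P + B * Q) * Q'" by (simp add: algebra_simps)
  finally have "Q dvd Q'" using bezout by simp
  then obtain r where r: "Q' = Q * r" by (elim dvdE)
  have "Q \<noteq> 0" "Q' \<noteq> 0" using pq pq' by (auto simp: is_exp_pade_def)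
  hence "degree r = 0" using r pq pq' by (auto simp: is_exp_pade_def degree_mult_eq)
  then obtain c where c: "r = [:c:]" by (elim degree_eq_zeroE)
  have "c = 1" using pq pq' r c by (simp add: is_exp_pade_def)
  hence "Q' = Q" using r c by simp
  thus "PQ' = (P, Q)" using eq \<open>Q \<noteq> 0\<close> by simp
qed

lemma exp_pade_pair_0_2: "exp_pade_pair 0 2 = ([:1:], [:1, -1, 1/2:])"
proof (rule exp_pade_pair_eqI)
  show "is_exp_pade 0 2 [:1:] [:1, -1, 1/2 :: complex:]"
    by (rule is_exp_padeI[where S = "[:0, -1/4:]"])
       (auto simp: eval_nat_numeral field_simps)
  show "[:1:] * [:1:] + [:0:] * [:1, -1, 1/2:] = (1 :: complex poly)" by simp
qed

lemma exp_pade_pair_1_2: "exp_pade_pair 1 2 = ([:1, 1/3:], [:1, -2/3, 1/6:])"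
proof (rule exp_pade_pair_eqI)
  show "is_exp_pade 1 2 [:1, 1/3:] [:1, -2/3, 1/6 :: complex:]"
    by (rule is_exp_padeI[where S = "[:1/36, -1/36:]"])
       (auto simp: eval_nat_numeral field_simps)
  show "[:7/9, -1/9:] * [:1, 1/3:] + [:2/9:] * [:1, -2/3, 1/6:] = (1 :: complex poly)"
    by simp
qed

lemma exp_pade_pair_1_3: "exp_pade_pair 1 3 = ([:1, 1/4:], [:1, -3/4, 1/4, -1/24:])"
proof (rule exp_pade_pair_eqI)
  show "is_exp_pade 1 3 [:1, 1/4:] [:1, -3/4, 1/4, -1/24 :: complex:]"
    by (rule is_exp_padeI[where S = "[:1/96, -1/288, 1/576:]"])
       (auto simp: eval_nat_numeral field_simps)
  show "[:29/32, -5/32, 1/64:] * [:1, 1/4:] + [:3/32:] * [:1, -3/4, 1/4, -1/24:] = (1 :: complex poly)"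
    by simp
qed

end

theory Submission
  imports Defs
begin

text \<open>
  On the imaginary axis the squared moduli are polynomials in \<open>\<omega>\<close>, and
  \<open>|Q|\<^sup>2 = |P|\<^sup>2 + c \<omega>\<^sup>q\<close>. With \<open>s = |R|\<close> and \<open>u = c \<omega>\<^sup>q\<close> this reads
  \<open>|Q|\<^sup>2 (1 + s) (1 - s) = u\<close>, and \<open>|Q|\<^sup>2 (1 + s) = 2 + O(\<omega>\<^sup>2)\<close> gives the expansion of
  the defect \<open>1 - s\<close>.
\<close>

lemma exp_pade_polys:
  "exp_pade_num 0 2 = [:1:]" "exp_pade_den 0 2 = [:1, -1, 1/2:]"
  "exp_pade_num 1 2 = [:1, 1/3:]" "exp_pade_den 1 2 = [:1, -2/3, 1/6:]"
  "exp_pade_num 1 3 = [:1, 1/4:]" "exp_pade_den 1 3 = [:1, -3/4, 1/4, -1/24:]"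
  using exp_pade_pair_0_2 exp_pade_pair_1_2 exp_pade_pair_1_3
  by (simp_all add: exp_pade_num_def exp_pade_den_def)

lemma exp_pade_num_imaginary:
  fixes \<omega> :: real
  shows "(cmod (poly (exp_pade_num 0 2) (\<i> * of_real \<omega>)))\<^sup>2 = 1"
    and "(cmod (poly (exp_pade_num 1 2) (\<i> * of_real \<omega>)))\<^sup>2 = 1 + 1/9 * \<omega>\<^sup>2"
    and "(cmod (poly (exp_pade_num 1 3) (\<i> * of_real \<omega>)))\<^sup>2 = 1 + 1/16 * \<omega>\<^sup>2"
  unfolding exp_pade_polys cmod_power2 by (simp_all add: power2_eq_square)

text \<open>Even coefficients give the real part and odd ones the imaginary part of the value at
  \<open>\<i> * of_real \<omega>\<close>. In the sum of their squares the intermediate powers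
  cancel: for \<open>1 3\<close> the coefficient of \<open>\<omega> ^ 4\<close> is 1/16 - 2 * (3/4)
  * (1/24) = 0.\<close>

lemma exp_pade_den_imaginary:
  fixes \<omega> :: real
  shows "(cmod (poly (exp_pade_den 0 2) (\<i> * of_real \<omega>)))\<^sup>2 = 1 + 1/4 * \<omega> ^ 4"
    and "(cmod (poly (exp_pade_den 1 2) (\<i> * of_real \<omega>)))\<^sup>2 = 1 + 1/9 * \<omega>\<^sup>2 + 1/36 * \<omega> ^ 4"
    and "(cmod (poly (exp_pade_den 1 3) (\<i> * of_real \<omega>)))\<^sup>2 = 1 + 1/16 * \<omega>\<^sup>2 + 1/576 * \<omega> ^ 6"
  unfolding exp_pade_polys cmod_power2
  by (simp_all add: eval_nat_numeral) (simp_all add: field_simps)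

text \<open>The bound is explicit, with constant \<open>c * (a + 2 * c)\<close> on the punctured
  interval where \<bar>\<omega>\<bar> < 1. Evenness of \<open>q\<close> makes
  \<open>c * \<omega> ^ q\<close> nonnegative, so that the square root lies in [0, 1].\<close>

lemma one_minus_sqrt_quotient_bigo:
  fixes a c :: real and q :: nat
  assumes "0 \<le> a" "0 \<le> c" "even q" "2 \<le> q"
  shows "(\<lambda>\<omega>::real. 1 - sqrt ((1 + a * \<omega>\<^sup>2) / (1 + a * \<omega>\<^sup>2 + c * \<omega> ^ q)) - c / 2 * \<omega> ^ q)
           \<in> O[at 0](\<lambda>\<omega>. \<omega> ^ (q + 2))"
proof (rule bigoI)
  have "eventually (\<lambda>\<omega>::real. \<bar>\<omega>\<bar> < 1) (at 0)"
    unfolding eventually_at by (intro exI[of _ 1]) auto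
  thus "eventually (\<lambda>\<omega>::real.
      norm (1 - sqrt ((1 + a * \<omega>\<^sup>2) / (1 + a * \<omega>\<^sup>2 + c * \<omega> ^ q)) - c / 2 * \<omega> ^ q)
        \<le> c * (a + 2 * c) * norm (\<omega> ^ (q + 2))) (at 0)"
  proof eventually_elim
    case (elim \<omega>)
    define u where "u = c * \<omega> ^ q"
    define v where "v = a * \<omega>\<^sup>2"
    define s where "s = sqrt ((1 + v) / (1 + v + u))"
    have v: "0 \<le> v" and u: "0 \<le> u"
      using assms by (auto simp: u_def v_def zero_le_even_power)
    \<comment> \<open>Since q \<ge> 2 and \<bar>\<omega>\<bar> < 1, \<open>u\<close> is bounded by a
      multiple of \<open>\<omega>\<^sup>2\<close>, like \<open>v\<close>; both then count as
      relative corrections.\<close>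
    have "\<bar>\<omega>\<bar> ^ q \<le> \<bar>\<omega>\<bar>\<^sup>2"
      using assms elim by (intro power_decreasing) auto
    hence u_le: "u \<le> c * \<omega>\<^sup>2"
      using assms by (auto simp: u_def power_even_abs intro: mult_left_mono)
    have s: "0 \<le> s" "s \<le> 1"
      using u v by (simp_all add: s_def divide_le_eq_1)
    have "s\<^sup>2 = (1 + v) / (1 + v + u)"
      using u v by (simp add: s_def)
    hence "(1 + v + u) * s\<^sup>2 = 1 + v"
      using u v by simp
    hence s2: "(1 + v + u) * (1 - s\<^sup>2) = u"
      by (simp only: right_diff_distrib) simp
    \<comment> \<open>As \<open>D * (1 - s) = u\<close>, comparing 1 - s with u/2 means comparing
      \<open>D\<close> with 2. The error factor \<open>E\<close> equals 2 - \<open>D\<close>,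
      written so that both of its terms are visibly small.\<close>
    define D where "D = (1 + v + u) * (1 + s)"
    define E where "E = (1 - s) - (v + u) * (1 + s)"
    have "1 * 1 \<le> D"
      unfolding D_def using u v s by (intro mult_mono) auto
    hence D: "1 \<le> D" by simp
    have "(1 + s) * (1 - s) = 1 - s\<^sup>2"
      by (simp add: power2_eq_square algebra_simps)
    hence factor: "D * (1 - s) = u"
      using s2 by (simp only: D_def mult.assoc)
    have le: "1 - s \<le> u"
      using mult_right_mono[OF D, of "1 - s"] factor s by simp
    have "D * (1 - s - u / 2) = D * (1 - s) - u / 2 * D"
      by (simp add: algebra_simps)
    also have "\<dots> = u / 2 * E"
      unfolding factor by (simp add: D_def E_def algebra_simps)
    finally have "\<bar>D * (1 - s - u / 2)\<bar> = \<bar>u / 2 * E\<bar>" by simp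
    hence abs_eq: "D * \<bar>1 - s - u / 2\<bar> = u / 2 * \<bar>E\<bar>"
      unfolding abs_mult using D u by simp
    \<comment> \<open>\<open>E\<close> is a difference of nonnegative terms: 1 - s is at most
      \<open>u\<close> and the other at most 2(v + u), so either sign of \<open>E\<close> is covered
      by 2(v + 2u).\<close>
    have E_le: "\<bar>E\<bar> \<le> 2 * (v + 2 * u)"
    proof -
      define W where "W = (v + u) * (1 + s)"
      have "0 \<le> W"
        unfolding W_def using u v s by simp
      moreover have "W \<le> (v + u) * 2"
        unfolding W_def using u v s by (intro mult_left_mono) auto
      ultimately show ?thesis
        using le s u v unfolding E_def W_def[symmetric] abs_le_iff by auto
    qed
    \<comment> \<open>\<open>D\<close> \<ge> 1 lets the factor \<open>D\<close> be inserted without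
      any division.\<close>
    have "\<bar>1 - s - u / 2\<bar> \<le> D * \<bar>1 - s - u / 2\<bar>"
      using mult_right_mono[OF D, of "\<bar>1 - s - u / 2\<bar>"] by simp
    also have "\<dots> \<le> u / 2 * (2 * (v + 2 * u))"
      unfolding abs_eq using E_le u by (intro mult_left_mono) auto
    also have "\<dots> = u * (v + 2 * u)" by simp
    also have "\<dots> \<le> u * ((a + 2 * c) * \<omega>\<^sup>2)"
      using u u_le by (intro mult_left_mono) (auto simp: v_def algebra_simps)
    also have "\<dots> = c * (a + 2 * c) * norm (\<omega> ^ (q + 2))"
    proof -
      have "norm (\<omega> ^ (q + 2)) = \<omega> ^ q * \<omega>\<^sup>2"
        using \<open>even q\<close> by (simp add: power_add abs_mult zero_le_even_power del: add_2_eq_Suc')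
      thus ?thesis by (simp add: u_def mult_ac)
    qed
    finally show ?case by (simp add: s_def u_def v_def)
  qed
qed

text \<open>Both claims depend on the approximant only through \<open>a\<close>, \<open>c\<close>
  and \<open>q\<close>, so the three cases are instances. The modulus is recovered as the
  nonnegative root of its square.\<close>

lemma exp_pade_imaginary_axis:
  fixes a c :: real and q :: nat
  assumes num: "\<And>\<omega>::real. (cmod (poly (exp_pade_num m n) (\<i> * of_real \<omega>)))\<^sup>2 = 1 + a * \<omega>\<^sup>2"
    and den: "\<And>\<omega>::real. (cmod (poly (exp_pade_den m n) (\<i> * of_real \<omega>)))\<^sup>2
                = 1 + a * \<omega>\<^sup>2 + c * \<omega> ^ q"
    and "0 \<le> a" "0 \<le> c" "even q" "2 \<le> q"
  shows "(cmod (exp_pade m n (\<i> * of_real \<omega>)))\<^sup>2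
           = (cmod (poly (exp_pade_num m n) (\<i> * of_real \<omega>)))\<^sup>2
             / ((cmod (poly (exp_pade_num m n) (\<i> * of_real \<omega>)))\<^sup>2 + c * \<omega> ^ q)"
    and "(\<lambda>\<omega>::real. 1 - cmod (exp_pade m n (\<i> * of_real \<omega>)) - c / 2 * \<omega> ^ q)
           \<in> O[at 0](\<lambda>\<omega>. \<omega> ^ (q + 2))"
proof -
  have square: "(cmod (exp_pade m n (\<i> * of_real \<omega>)))\<^sup>2
      = (1 + a * \<omega>\<^sup>2) / (1 + a * \<omega>\<^sup>2 + c * \<omega> ^ q)" for \<omega>
    by (simp add: exp_pade_def norm_divide power_divide num den)
  show "(cmod (exp_pade m n (\<i> * of_real \<omega>)))\<^sup>2
      = (cmod (poly (exp_pade_num m n) (\<i> * of_real \<omega>)))\<^sup>2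
        / ((cmod (poly (exp_pade_num m n) (\<i> * of_real \<omega>)))\<^sup>2 + c * \<omega> ^ q)"
    by (simp only: square num)
  have "cmod (exp_pade m n (\<i> * of_real \<omega>))
      = sqrt ((1 + a * \<omega>\<^sup>2) / (1 + a * \<omega>\<^sup>2 + c * \<omega> ^ q))" for \<omega>
    by (simp flip: square)
  thus "(\<lambda>\<omega>::real. 1 - cmod (exp_pade m n (\<i> * of_real \<omega>)) - c / 2 * \<omega> ^ q)
      \<in> O[at 0](\<lambda>\<omega>. \<omega> ^ (q + 2))"
    using one_minus_sqrt_quotient_bigo[OF assms(3-6)] by simp
qed

theorem proposition5p6:
  shows "(\<forall>\<omega>::real.
            (cmod (poly (exp_pade_den 0 2) (\<i> * of_real \<omega>)))\<^sup>2
              - (cmod (poly (exp_pade_num 0 2) (\<i> * of_real \<omega>)))\<^sup>2 = \<omega> ^ 4 / 4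
          \<and> (cmod (poly (exp_pade_den 1 2) (\<i> * of_real \<omega>)))\<^sup>2
              - (cmod (poly (exp_pade_num 1 2) (\<i> * of_real \<omega>)))\<^sup>2 = \<omega> ^ 4 / 36
          \<and> (cmod (poly (exp_pade_den 1 3) (\<i> * of_real \<omega>)))\<^sup>2
              - (cmod (poly (exp_pade_num 1 3) (\<i> * of_real \<omega>)))\<^sup>2 = \<omega> ^ 6 / 576
          \<and> (cmod (poly (exp_pade_num 0 2) (\<i> * of_real \<omega>)))\<^sup>2 = 1
          \<and> (cmod (poly (exp_pade_num 1 2) (\<i> * of_real \<omega>)))\<^sup>2 = 1 + \<omega>\<^sup>2 / 9
          \<and> (cmod (poly (exp_pade_num 1 3) (\<i> * of_real \<omega>)))\<^sup>2 = 1 + \<omega>\<^sup>2 / 16)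
       \<and> (\<forall>(m, n, c, q) \<in> {(0, 2, 1/4, 4), (1, 2, 1/36, 4), (1, 3, 1/576, 6)}
              :: (nat \<times> nat \<times> real \<times> nat) set.
            (\<forall>\<omega>::real.
               (cmod (exp_pade m n (\<i> * of_real \<omega>)))\<^sup>2
                 = (cmod (poly (exp_pade_num m n) (\<i> * of_real \<omega>)))\<^sup>2
                   / ((cmod (poly (exp_pade_num m n) (\<i> * of_real \<omega>)))\<^sup>2 + c * \<omega> ^ q))
          \<and> (\<lambda>\<omega>::real. (1 - cmod (exp_pade m n (\<i> * of_real \<omega>))) - c / 2 * \<omega> ^ q)
              \<in> O[at 0](\<lambda>\<omega>. \<omega> ^ (q + 2)))"
proof -
  note moduli = exp_pade_num_imaginary exp_pade_den_imaginary
  \<comment> \<open>The numerator for \<open>0 2\<close> is constant, so \<open>a = 0\<close>; these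
    equations bring the instantiated hypotheses to the form of the computed moduli.\<close>
  have zero_coeff: "1 + 0 * \<omega>\<^sup>2 = 1" "1 + 0 * \<omega>\<^sup>2 + 1/4 * \<omega> ^ 4 = 1 + 1/4 * \<omega> ^ 4" for \<omega> :: real
    by simp_all
  note 02 = exp_pade_imaginary_axis[of 0 2 0 "1/4" 4, unfolded zero_coeff, OF moduli(1,4)]
  note 12 = exp_pade_imaginary_axis[of 1 2 "1/9" "1/36" 4, OF moduli(2,5)]
  note 13 = exp_pade_imaginary_axis[of 1 3 "1/16" "1/576" 6, OF moduli(3,6)]
  show ?thesis (is "?moduli \<and> ?axis")
  proof
    show ?moduli
      by (simp only: moduli) simp
    show ?axis
      unfolding ball_simps prod.case
      by (intro conjI allI TrueI 02 12 13) simp_all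
  qed
qed

end
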